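(* Consider the bi-objective linear program $$\text{(BLP)}\quad \min\ \begin{pmatrix}(c^1)^\top x+(f^1)^\top y\\ (c^2)^\top x+(f^2)^\top y\end{pmatrix}\quad\text{s.t. } Ax+By\geq b,\ Dy\geq d,\ x\geq 0,\ y\geq 0 .$$ Let $\mathcal X_e=\{(x^1,y^1),\dots,(x^q,y^q)\}$ be a complete set of efficient extreme solutions of (BLP), ordered by strictly increasing first objective value. Let $[a_{i+1},a_i]$, $i=1,\dots,q$, with $a_1=1$ and $a_{q+1}=0$, be the corresponding optimality ranges, i.e. $(x^i,y^i)$ is optimal for the weighted-sum problem $\lambda$-(BLP) for all $\lambda\in[a_{i+1},a_i]$. Let $\mathcal Z_n=\{(z_1^1,z_2^1),\dots,(z_1^q,z_2^q)\}$ be the corresponding set of non-dominated extreme points. Put $\theta_1^i=(c^1)^\top x^i$ and $\theta_2^i=(c^2)^\top x^i$ for $i=1,\dots,q$. Then $$\mathcal X_e^r=\{(\theta_1^1,\theta_2^1,y^1),\dots,(\theta_1^q,\theta_2^q,y^q)\}$$ comprises a complete set of efficient extreme solutions of a Benders reformulation $\mathrm{BR}\{\bar{\mathcal D}_r,\Lambda,\bar{\mathcal D}_p\}$ of (BLP), and this reformulation has the same set of non-dominated extreme points $\mathcal Z_n$, where $(z_1^i,z_2^i)=\big((f^1)^\top y^i+\theta_1^i,\ (f^2)^\top y^i+\theta_2^i\big)$. In particular, the index range $\lambda\in[0,1]$ in the complete Benders reformulation can be replaced with $\lambda\in\Lambda=\{a_1,a_2,\dots,a_q\}$ in $\mathrm{BR}\{\bar{\mathcal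 D}_r,\Lambda,\bar{\mathcal D}_p\}$.
   Context: All data are real: $x\in\mathbb R^n$, $y\in\mathbb R^p$, and the vectors $c^1,c^2,f^1,f^2,b,d$ and matrices $A,B,D$ have matching dimensions ($b\in\mathbb R^m$). Inequalities between vectors in constraints are componentwise. Bi-objective notions. For a bi-objective linear program with objective vector $z=(z_1,z_2)$ (both minimised), a point $z$ dominates $\bar z$ if $z_i\le\bar z_i$ for $i=1,2$ and $z\ne\bar z$. A feasible solution is efficient if its objective vector is not dominated by that of any other feasible solution; the objective vectors of efficient solutions are the non-dominated points. A non-dominated extreme point is a non-dominated point that is an extreme point of the (polyhedral) feasible set in objective space. An efficient extreme solution is an efficient solution whose objective vector is a non-dominated extreme point. A complete set of efficient extreme solutions contains at least one efficient extreme solution for each non-dominated extreme point. For $\lambda\in[0,1]$, the weighted-sum problem $\lambda$-(P) of a bi-objective problem (P) has the same constraints and the single objective $\lambda z_1+(1-\lambda)z_2$. Standing assumptions: (BLP) is feasible, and the set of efficient solutions of every bi-objective problem considered is bounded (no unbounded efficient edges); in particular $\lambda$-(BLP) has an optimal solution for every $\lambda\in[0,1]$. Benders reformulation. For $\lambda\in[0,1]$ let $c^\lambda=\lambda c^1+(1-\lambda)c^2$ and $\mathcal D^\lambda=\{\pi\in\mathbb R^m: A^\top\pi\leq c^\lambda,\ \pi\geq 0\}$. Let $\mathcal D_p^\lambda$ be the set of extreme points of $\mathcal D^\lambda$ and $\mathcal D_r$ the set of extreme rays (one representative each) of $\{\pi: A^\top\pi\leq 0,\ \pi\geq 0\}$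 (independent of $\lambda$). The complete Benders reformulation, with variables $\theta_1,\theta_2\in\mathbb R$ (free) and $y$, is $$\min\begin{pmatrix}\theta_1+(f^1)^\top y\\ \theta_2+(f^2)^\top y\end{pmatrix}\ \text{s.t. } Dy\geq d,\ y\geq0,\quad (b-By)^\top\pi_r\leq0\ \ \forall\pi_r\in\mathcal D_r,$$ $$(b-By)^\top\pi_p^\lambda\leq\lambda\theta_1+(1-\lambda)\theta_2\ \ \forall\lambda\in[0,1],\ \forall\pi_p^\lambda\in\mathcal D_p^\lambda .$$ For $\Lambda\subseteq[0,1]$, $\bar{\mathcal D}_r\subseteq\mathcal D_r$ and $\bar{\mathcal D}_p(\lambda)\subseteq\mathcal D_p^\lambda$ for $\lambda\in\Lambda$, $\mathrm{BR}\{\bar{\mathcal D}_r,\Lambda,\bar{\mathcal D}_p\}$ denotes the same problem with only the cuts for $\pi_r\in\bar{\mathcal D}_r$ and for $\lambda\in\Lambda$, $\pi_p^\lambda\in\bar{\mathcal D}_p(\lambda)$.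
   Formalization: The formal theorem takes Λ = {a_1,…,a_q,a_{q+1}} with a_{q+1}=0; with the printed Λ = {a_1,…,a_q} the claim is false: for q=1, θ_2 is unbounded below and no efficient solution exists; for q≥2 the last point z^q is no longer extreme. *)

theory Defs
  imports "HOL-Analysis.Analysis"
begin

section \<open>Bi-objective minimisation over a feasible set \<open>X\<close> with objective map \<open>z\<close>\<close>

definition dominates :: "real \<times> real \<Rightarrow> real \<times> real \<Rightarrow> bool" where
  "dominates v w \<longleftrightarrow> fst v \<le> fst w \<and> snd v \<le> snd w \<and> v \<noteq> w"

definition efficient_solutions :: "'s set \<Rightarrow> ('s \<Rightarrow> real \<times> real) \<Rightarrow> 's set" where
  "efficient_solutions X z = {s \<in> X. \<not> (\<exists>t\<in>X. dominates (z t) (z s))}"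

definition nondominated_points :: "'s set \<Rightarrow> ('s \<Rightarrow> real \<times> real) \<Rightarrow> (real \<times> real) set" where
  "nondominated_points X z = z ` efficient_solutions X z"

definition nondominated_extreme_points ::
    "'s set \<Rightarrow> ('s \<Rightarrow> real \<times> real) \<Rightarrow> (real \<times> real) set" where
  "nondominated_extreme_points X z =
     {v \<in> nondominated_points X z. v extreme_point_of (z ` X)}"

definition efficient_extreme_solutions :: "'s set \<Rightarrow> ('s \<Rightarrow> real \<times> real) \<Rightarrow> 's set" where
  "efficient_extreme_solutions X z =
     {s \<in> efficient_solutions X z. z s \<in> nondominated_extreme_points X z}"

definition complete_efficient_extreme_set ::
    "'s set \<Rightarrow> ('s \<Rightarrow> real \<times> real) \<Rightarrow> 's set \<Rightarrow> bool" where
  "complete_efficient_extreme_set X z E \<longleftrightarrow>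
     E \<subseteq> efficient_extreme_solutions X z \<and>
     (\<forall>v \<in> nondominated_extreme_points X z. \<exists>s\<in>E. z s = v)"

definition weighted_sum :: "real \<Rightarrow> real \<times> real \<Rightarrow> real" where
  "weighted_sum \<mu> v = \<mu> * fst v + (1 - \<mu>) * snd v"

definition weighted_sum_optimal ::
    "'s set \<Rightarrow> ('s \<Rightarrow> real \<times> real) \<Rightarrow> real \<Rightarrow> 's \<Rightarrow> bool" where
  "weighted_sum_optimal X z \<mu> s \<longleftrightarrow>
     s \<in> X \<and> (\<forall>t\<in>X. weighted_sum \<mu> (z s) \<le> weighted_sum \<mu> (z t))"


section \<open>The bi-objective linear program\<close>

text \<open>The order \<open>\<le>\<close> on \<open>real ^ 'i\<close> is the componentwise one.\<close>

definition blp_feasible ::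
    "real^'n^'m \<Rightarrow> real^'p^'m \<Rightarrow> real^'m \<Rightarrow> real^'p^'k \<Rightarrow> real^'k \<Rightarrow> ((real^'n) \<times> (real^'p)) set" where
  "blp_feasible A B b D d =
     {(x, y). b \<le> A *v x + B *v y \<and> d \<le> D *v y \<and> 0 \<le> x \<and> 0 \<le> y}"

definition blp_objective ::
    "real^'n \<Rightarrow> real^'n \<Rightarrow> real^'p \<Rightarrow> real^'p \<Rightarrow> (real^'n) \<times> (real^'p) \<Rightarrow> real \<times> real" where
  "blp_objective c1 c2 f1 f2 = (\<lambda>(x, y). (c1 \<bullet> x + f1 \<bullet> y, c2 \<bullet> x + f2 \<bullet> y))"


section \<open>Benders reformulations\<close>

definition dual_polyhedron :: "real^'n^'m \<Rightarrow> real^'n \<Rightarrow> (real^'m) set" where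
  "dual_polyhedron A c = {\<pi>. transpose A *v \<pi> \<le> c \<and> 0 \<le> \<pi>}"

definition weighted_cost :: "real^'n \<Rightarrow> real^'n \<Rightarrow> real \<Rightarrow> real^'n" where
  "weighted_cost c1 c2 \<mu> = \<mu> *\<^sub>R c1 + (1 - \<mu>) *\<^sub>R c2"

definition dual_extreme_points :: "real^'n^'m \<Rightarrow> real^'n \<Rightarrow> real^'n \<Rightarrow> real \<Rightarrow> (real^'m) set" where
  "dual_extreme_points A c1 c2 \<mu> =
     {\<pi>. \<pi> extreme_point_of (dual_polyhedron A (weighted_cost c1 c2 \<mu>))}"

text \<open>An extreme ray is a half-line from the origin that is a face of the cone;
  a nonzero vector \<open>r\<close> represents the ray \<open>{t *\<^sub>R r | t. 0 \<le> t}\<close> it spans.\<close>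

definition represents_extreme_ray :: "'v::real_vector set \<Rightarrow> 'v \<Rightarrow> bool" where
  "represents_extreme_ray C r \<longleftrightarrow> r \<noteq> 0 \<and> (conic hull {r}) face_of C"

text \<open>\<open>R\<close> contains exactly one representative of each extreme ray of \<open>C\<close>.\<close>

definition extreme_ray_representatives :: "'v::real_vector set \<Rightarrow> 'v set \<Rightarrow> bool" where
  "extreme_ray_representatives C R \<longleftrightarrow>
     (\<forall>r\<in>R. represents_extreme_ray C r) \<and>
     (\<forall>r. represents_extreme_ray C r \<longrightarrow> (\<exists>!s. s \<in> R \<and> conic hull {s} = conic hull {r}))"

text \<open>The problem with cuts for the rays in \<open>R\<close> and, for each \<open>\<mu> \<in> L\<close>, the points in \<open>P \<mu>\<close>.
  A solution is a triple \<open>(\<theta>\<^sub>1, \<theta>\<^sub>2, y)\<close>.\<close>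

definition br_feasible ::
    "real^'p^'m \<Rightarrow> real^'m \<Rightarrow> real^'p^'k \<Rightarrow> real^'k \<Rightarrow>
     (real^'m) set \<Rightarrow> real set \<Rightarrow> (real \<Rightarrow> (real^'m) set) \<Rightarrow> (real \<times> real \<times> (real^'p)) set" where
  "br_feasible B b D d R L P =
     {(\<theta>1, \<theta>2, y). d \<le> D *v y \<and> 0 \<le> y \<and>
        (\<forall>\<pi>\<in>R. (b - B *v y) \<bullet> \<pi> \<le> 0) \<and>
        (\<forall>\<mu>\<in>L. \<forall>\<pi>\<in>P \<mu>. (b - B *v y) \<bullet> \<pi> \<le> \<mu> * \<theta>1 + (1 - \<mu>) * \<theta>2)}"

definition br_objective ::
    "real^'p \<Rightarrow> real^'p \<Rightarrow> real \<times> real \<times> (real^'p) \<Rightarrow> real \<times> real" where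
  "br_objective f1 f2 = (\<lambda>(\<theta>1, \<theta>2, y). (\<theta>1 + f1 \<bullet> y, \<theta>2 + f2 \<bullet> y))"

end

theory Submission
  imports Defs
begin

text \<open>Projecting a Benders reformulation to objective space gives a set \<open>W\<close> containing the image \<open>Z\<close>
  of the linear program, since a feasible \<open>(x, y)\<close> yields the feasible triple
  \<open>(c1 \<bullet> x, c2 \<bullet> x, y)\<close>. By duality, the cuts for a weight \<open>\<mu>\<close> force \<open>W\<close> to lie above the
  supporting line of \<open>Z\<close> with weight \<open>\<mu>\<close>. The lines for the weights \<open>a i\<close> (including the last one,
  \<open>0\<close>) already suffice: those for \<open>a i\<close> and \<open>a (i + 1)\<close> differ and meet in \<open>z i\<close>, so \<open>z i\<close> stays extreme and
  nondominated in \<open>W\<close>, and everything above all of them is weakly dominated by a point of the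
  convex hull of the \<open>z i\<close>, so no further nondominated extreme point can appear.\<close>

section \<open>Linear programming duality by extreme points and extreme rays\<close>

lemma closed_linear_image_orthant:
  fixes f :: "'a::euclidean_space \<Rightarrow> 'b::euclidean_space"
  assumes "linear f"
  shows "closed (f ` {u. \<forall>i\<in>Basis. 0 \<le> u \<bullet> i})" "convex_cone (f ` {u. \<forall>i\<in>Basis. 0 \<le> u \<bullet> i})"
proof -
  let ?O = "{u::'a. \<forall>i\<in>Basis. 0 \<le> u \<bullet> i}"
  have cone: "convex_cone ?O"
    by (auto simp: convex_cone_iff inner_simps)
  \<comment> \<open>A linear image of a closed cone need not be closed, but a finitely generated
    cone is; hence the orthant is written as a hull of finitely many vectors.\<close>
  have "?O = convex_cone hull Basis"
  proof
    show "convex_cone hull Basis \<subseteq> ?O"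
      by (rule hull_minimal) (auto simp: cone inner_Basis)
    show "?O \<subseteq> convex_cone hull Basis"
    proof
      fix u assume u: "u \<in> ?O"
      have "(\<Sum>i\<in>S. (u \<bullet> i) *\<^sub>R i) \<in> convex_cone hull Basis" if "finite S" "S \<subseteq> Basis" for S
        using that
      proof (induction S rule: finite_induct)
        case empty
        show ?case by (simp add: convex_cone_hull_contains_0)
      next
        case (insert i S)
        then show ?case
          using u by (auto intro!: convex_cone_hull_add convex_cone_hull_mul intro: hull_inc)
      qed
      from this[of Basis] show "u \<in> convex_cone hull Basis"
        by (simp add: euclidean_representation)
    qed
  qed
  then show "closed (f ` ?O)"
    by (metis closed_convex_cone_hull convex_cone_hull_linear_image[OF assms] finite_Basis
        finite_imageI)
  show "convex_cone (f ` ?O)"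
    using cone assms by (simp add: convex_cone_linear_image)
qed

text \<open>Strict separation only gives some threshold \<open>\<beta>\<close>; closure under
  scaling moves it to 0.\<close>

lemma separation_from_closed_convex_cone:
  fixes S :: "'a::euclidean_space set"
  assumes "closed S" "convex_cone S" "v \<notin> S"
  obtains h where "h \<bullet> v < 0" "\<And>u. u \<in> S \<Longrightarrow> 0 \<le> h \<bullet> u"
proof -
  obtain h \<beta> where h: "h \<bullet> v < \<beta>" and pos: "\<And>u. u \<in> S \<Longrightarrow> \<beta> < h \<bullet> u"
    using separating_hyperplane_closed_point[of S v] assms by (auto simp: convex_cone_def)
  have "\<beta> < 0"
    using pos[of 0] assms(2) by (simp add: convex_cone_contains_0)
  have "0 \<le> h \<bullet> u" if u: "u \<in> S" for u
  proof (rule ccontr)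
    assume neg: "\<not> 0 \<le> h \<bullet> u"
    \<comment> \<open>This multiple of \<open>u\<close> has \<open>h\<close>-value exactly
      \<open>\<beta>\<close>, against the strict inequality \<open>pos\<close>.\<close>
    then have "(\<beta> / (h \<bullet> u)) *\<^sub>R u \<in> S"
      using u assms(2) \<open>\<beta> < 0\<close> by (intro convex_cone_scaleR) (auto simp: divide_nonpos_neg)
    from pos[OF this] neg show False by simp
  qed
  with h \<open>\<beta> < 0\<close> show ?thesis by (intro that[of h]) auto
qed

lemma inner_mono_vec:
  fixes u v w :: "real^'n"
  assumes "u \<le> v" "0 \<le> w"
  shows "u \<bullet> w \<le> v \<bullet> w"
  using assms by (auto simp: inner_vec_def less_eq_vec_def intro!: sum_mono mult_right_mono)

lemma inner_transpose_matrix_vector: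
  fixes A :: "real^'n^'m"
  shows "(transpose A *v \<pi>) \<bullet> x = \<pi> \<bullet> (A *v x)"
  by (simp add: dot_lmul_matrix)

lemma inner_axis_one:
  fixes c :: "real^'n"
  shows "c \<bullet> axis i 1 = c $ i"
  by (simp add: inner_axis)

lemma nonneg_vec_iff_Basis:
  fixes x :: "real^'n"
  shows "0 \<le> x \<longleftrightarrow> (\<forall>i\<in>Basis. 0 \<le> x \<bullet> i)"
  by (auto simp: less_eq_vec_def Basis_vec_def inner_axis)

text \<open>The multiplier \<open>s\<close> of the cost row is not normalised to 1:
  \<open>s = 0\<close> covers certificates of primal infeasibility and \<open>s > 0\<close> covers
  scaled dual solutions.\<close>

lemma farkas_bounded_cost:
  fixes A :: "real^'n^'m"
  assumes "\<And>\<pi> s. 0 \<le> \<pi> \<Longrightarrow> 0 \<le> s \<Longrightarrow> transpose A *v \<pi> \<le> s *\<^sub>R c \<Longrightarrow> g \<bullet> \<pi> \<le> s * t"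
  shows "\<exists>x\<ge>0. g \<le> A *v x \<and> c \<bullet> x \<le> t"
proof -
  \<comment> \<open>With \<open>w\<close> and \<open>r\<close> as slacks, the wanted
    \<open>x\<close> exists iff \<open>(g, t)\<close> is the image of a nonnegative vector under
    \<open>f\<close>.\<close>
  define f :: "(real^'n) \<times> (real^'m) \<times> real \<Rightarrow> (real^'m) \<times> real"
    where "f = (\<lambda>(x, w, r). (A *v x - w, c \<bullet> x + r))"
  have lin: "linear f"
    by (rule linearI)
       (auto simp: f_def matrix_vector_right_distrib inner_simps matrix_vector_mult_scaleR algebra_simps)
  let ?O = "{u::(real^'n) \<times> (real^'m) \<times> real. \<forall>i\<in>Basis. 0 \<le> u \<bullet> i}"
  have mem: "(x, w, r) \<in> ?O \<longleftrightarrow> 0 \<le> x \<and> 0 \<le> w \<and> 0 \<le> r" for x w r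
    by (auto simp add: Basis_prod_def nonneg_vec_iff_Basis ball_Un)
  have "(g, t) \<in> f ` ?O"
  proof (rule ccontr)
    assume "(g, t) \<notin> f ` ?O"
    then obtain h where h: "h \<bullet> (g, t) < 0" and hpos: "\<And>u. u \<in> f ` ?O \<Longrightarrow> 0 \<le> h \<bullet> u"
      using separation_from_closed_convex_cone[OF closed_linear_image_orthant[OF lin]] by blast
    obtain \<rho> s where hs: "h = (\<rho>, s)" by (cases h)
    have pos: "0 \<le> \<rho> \<bullet> (A *v x - w) + s * (c \<bullet> x + r)" if "0 \<le> x" "0 \<le> w" "0 \<le> r" for x w r
    proof -
      have "f (x, w, r) \<in> f ` ?O" using mem that by blast
      from hpos[OF this] show ?thesis by (simp add: hs f_def)
    qed
    \<comment> \<open>Testing \<open>pos\<close> on unit vectors in the \<open>r\<close>,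
      \<open>w\<close> and \<open>x\<close> blocks in turn makes \<open>(- \<rho>, s)\<close> an
      admissible multiplier, which violates the assumed bound.\<close>
    have "0 \<le> s"
      using pos[of 0 0 1] by simp
    moreover have "0 \<le> - \<rho>"
      unfolding less_eq_vec_def
    proof
      fix i
      show "0 $ i \<le> (- \<rho>) $ i"
        using pos[of 0 "axis i 1" 0] by (simp add: less_eq_vec_def axis_def
            inner_axis_one[unfolded axis_def])
    qed
    moreover have "transpose A *v (- \<rho>) \<le> s *\<^sub>R c"
      unfolding less_eq_vec_def
    proof
      fix i
      have "0 \<le> \<rho> \<bullet> (A *v axis i 1) + s * (c \<bullet> axis i 1)"
        using pos[of "axis i 1" 0 0] by (simp add: less_eq_vec_def axis_def)
      moreover have "(transpose A *v (- \<rho>)) $ i = - (\<rho> \<bullet> (A *v axis i 1))"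
        using inner_transpose_matrix_vector[of A "- \<rho>" "axis i 1"]
        by (simp only: inner_axis_one inner_minus_left)
      ultimately show "(transpose A *v (- \<rho>)) $ i \<le> (s *\<^sub>R c) $ i"
        by (simp add: inner_axis_one)
    qed
    ultimately have "g \<bullet> (- \<rho>) \<le> s * t"
      using assms by blast
    then show False
      using h by (simp add: hs inner_commute)
  qed
  then obtain u where "(g, t) = f u" "u \<in> ?O" by (rule imageE)
  moreover obtain x w r where "u = (x, w, r)" by (cases u)
  ultimately have "(x, w, r) \<in> ?O" and f: "f (x, w, r) = (g, t)" by simp_all
  then have nn: "0 \<le> x" "0 \<le> w" "0 \<le> r" using mem by blast+
  moreover have "g \<le> A *v x"
  proof -
    have "g = A *v x - w" using f by (simp add: f_def)
    then show ?thesis using nn by (simp add: less_eq_vec_def)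
  qed
  ultimately show ?thesis using f by (auto simp: f_def)
qed

section \<open>Cones described by the extreme points of a slice\<close>

lemma extreme_point_of_slice_spans_face:
  fixes C :: "'a::real_vector set" and e :: "'a \<Rightarrow> real"
  assumes "convex_cone C" "linear e" and pos: "\<And>v. v \<in> C \<Longrightarrow> v \<noteq> 0 \<Longrightarrow> 0 < e v"
    and p: "p extreme_point_of {v \<in> C. e v = 1}"
  shows "(conic hull {p}) face_of C"
proof -
  have hull: "v \<in> conic hull {p} \<longleftrightarrow> (\<exists>k\<ge>0. v = k *\<^sub>R p)" for v
    by (auto simp: conic_hull_explicit)
  have pC: "p \<in> C" and ep: "e p = 1"
    using p by (auto simp: extreme_point_of_def)
  have esc: "e (k *\<^sub>R v) = k * e v" and eadd: "e (v + w) = e v + e w" for k v w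
    using assms(2) by (auto simp: linear_cmul linear_add)
  have C: "conic C" "convex C" using assms(1) by (auto simp: convex_cone_def)
  \<comment> \<open>Scaled to \<open>e\<close>-value 1, the endpoints lie in the slice with
    \<open>p\<close> between them, so extremality of \<open>p\<close> collapses both to
    \<open>p\<close>. A zero endpoint cannot be scaled and is treated separately.\<close>
  have "a \<in> conic hull {p} \<and> b \<in> conic hull {p}"
    if ab: "a \<in> C" "b \<in> C" and x: "x \<in> conic hull {p}" "x \<in> open_segment a b" for a b x
  proof -
    obtain u where u: "0 \<le> u" "x = u *\<^sub>R p" using x hull by auto
    obtain \<tau> where \<tau>: "0 < \<tau>" "\<tau> < 1" "x = (1 - \<tau>) *\<^sub>R a + \<tau> *\<^sub>R b"
      using x by (auto simp: in_segment)
    have ua: "u = (1 - \<tau>) * e a + \<tau> * e b"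
      using arg_cong[OF \<tau>(3), of e] by (simp add: u esc eadd ep)
    consider "a = 0" | "b = 0" | "a \<noteq> 0" "b \<noteq> 0" by blast
    then show ?thesis
    proof cases
      case 1
      then have "b = (1 / \<tau>) *\<^sub>R (u *\<^sub>R p)" using \<tau> u by simp
      then have "b = (u / \<tau>) *\<^sub>R p" by simp
      then show ?thesis using 1 u \<tau> hull by (metis divide_nonneg_pos order_refl scaleR_zero_left)
    next
      case 2
      then have "a = (1 / (1 - \<tau>)) *\<^sub>R (u *\<^sub>R p)" using \<tau> u by simp
      then have "a = (u / (1 - \<tau>)) *\<^sub>R p" by simp
      then show ?thesis
        using 2 u \<tau> hull by (metis diff_gt_0_iff_gt divide_nonneg_pos order_refl scaleR_zero_left)
    next
      case 3
      then have ea: "0 < e a" "0 < e b" using pos ab by auto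
      define a' where "a' = (1 / e a) *\<^sub>R a"
      define b' where "b' = (1 / e b) *\<^sub>R b"
      have a: "a = e a *\<^sub>R a'" "b = e b *\<^sub>R b'" using ea by (auto simp: a'_def b'_def)
      have in': "a' \<in> {v \<in> C. e v = 1}" "b' \<in> {v \<in> C. e v = 1}"
        using ea ab C(1) by (auto simp: a'_def b'_def esc conic_def)
      have up: "0 < u" unfolding ua using \<tau> ea by (simp add: add_pos_pos)
      \<comment> \<open>The weight of \<open>b'\<close> in \<open>p\<close>, the point
        \<open>x\<close> divided by its \<open>e\<close>-value \<open>u\<close>; \<open>ua\<close>
        makes the two weights sum to 1.\<close>
      define \<sigma> where "\<sigma> = \<tau> * e b / u"
      have \<sigma>: "0 < \<sigma>" "\<sigma> < 1" "1 - \<sigma> = (1 - \<tau>) * e a / u"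
      proof -
        have c: "0 < (1 - \<tau>) * e a" "0 < \<tau> * e b" using \<tau> ea by auto
        then show "0 < \<sigma>" "\<sigma> < 1" using up ua by (auto simp: \<sigma>_def)
        show "1 - \<sigma> = (1 - \<tau>) * e a / u" using up ua by (simp add: \<sigma>_def field_simps)
      qed
      have "p = (1 / u) *\<^sub>R x" using u up by simp
      also have "\<dots> = (1 - \<sigma>) *\<^sub>R a' + \<sigma> *\<^sub>R b'"
        unfolding \<sigma>(3) unfolding \<tau>(3) \<sigma>_def using ea
        by (simp add: a'_def b'_def scaleR_right_distrib)
      finally have pe: "p = (1 - \<sigma>) *\<^sub>R a' + \<sigma> *\<^sub>R b'" .
      have "a' = b'"
      proof (rule ccontr)
        assume "a' \<noteq> b'"
        then have "p \<in> open_segment a' b'" using pe \<sigma> by (auto simp: in_segment)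
        then show False using p in' by (auto simp: extreme_point_of_def)
      qed
      then have "a' = p" "b' = p" using pe by (auto simp flip: scaleR_left_distrib)
      then show ?thesis using a ea hull by (metis less_imp_le)
    qed
  qed
  moreover have "conic hull {p} \<subseteq> C"
    using C(1) pC by (simp add: hull_minimal)
  ultimately show ?thesis
    unfolding face_of_def by (blast intro: convex_conic_hull convex_singleton)
qed

text \<open>By Krein-Milman the bound passes from the extreme points to the whole slice, and every
  nonzero vector of the cone is a positive multiple of a slice point.\<close>

lemma linear_bound_on_cone_of_slice:
  fixes C :: "'a::euclidean_space set" and e :: "'a \<Rightarrow> real"
  assumes "convex_cone C" "linear e" "\<And>v. v \<in> C \<Longrightarrow> v \<noteq> 0 \<Longrightarrow> 0 < e v"
    and "compact {v \<in> C. e v = 1}"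
    and ext: "\<And>p. p extreme_point_of {v \<in> C. e v = 1} \<Longrightarrow> l \<bullet> p \<le> 0"
    and "v \<in> C"
  shows "l \<bullet> v \<le> 0"
proof (cases "v = 0")
  case False
  let ?S = "{v \<in> C. e v = 1}"
  have "convex ?S"
    using assms(1,2) by (auto simp: convex_cone_def convex_def linear_add linear_cmul)
  then have "?S = convex hull {p. p extreme_point_of ?S}"
    by (rule Krein_Milman_Minkowski[OF assms(4)])
  moreover have "convex hull {p. p extreme_point_of ?S} \<subseteq> {p. l \<bullet> p \<le> 0}"
    using ext by (intro hull_minimal convex_halfspace_le) blast
  ultimately have "?S \<subseteq> {p. l \<bullet> p \<le> 0}" by (rule ord_eq_le_trans)
  moreover have ev: "0 < e v" using assms False by blast
  then have "(1 / e v) *\<^sub>R v \<in> ?S"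
    using assms(1,2,6) by (auto simp: linear_cmul convex_cone_scaleR)
  ultimately have "l \<bullet> ((1 / e v) *\<^sub>R v) \<le> 0" by blast
  then show ?thesis using ev by (simp add: divide_le_0_iff)
qed simp

text \<open>Homogenising the dual polyhedron \<open>P\<close> to the cone over \<open>P \<times> {1}\<close> treats extreme points
  (last coordinate positive) and extreme rays (last coordinate zero) alike: both come from
  extreme points of one compact slice.\<close>

lemma cuts_bound_homogenised_dual:
  fixes A :: "real^'n^'m"
  assumes ray: "\<And>r. represents_extreme_ray (dual_polyhedron A 0) r \<Longrightarrow> g \<bullet> r \<le> 0"
    and pt: "\<And>\<pi>. \<pi> extreme_point_of (dual_polyhedron A c) \<Longrightarrow> g \<bullet> \<pi> \<le> t"
    and v: "0 \<le> \<pi>0" "0 \<le> s0" "transpose A *v \<pi>0 \<le> s0 *\<^sub>R c"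
  shows "g \<bullet> \<pi>0 \<le> s0 * t"
proof -
  \<comment> \<open>At height \<open>s = 1\<close> this cone is the dual polyhedron for
    \<open>c\<close>, at height 0 its recession cone \<open>dual_polyhedron A 0\<close>.\<close>
  define K where "K = {(\<pi>, s). 0 \<le> \<pi> \<and> (0::real) \<le> s \<and> transpose A *v \<pi> \<le> s *\<^sub>R c}"
  \<comment> \<open>All coordinates are nonnegative on \<open>K\<close>, so their sum vanishes only
    at 0 and its level set at 1 is bounded.\<close>
  define e where "e = (\<lambda>(\<pi>::real^'m, s::real). (\<Sum>i\<in>UNIV. \<pi> $ i) + s)"
  have K: "convex_cone K"
    unfolding convex_cone_iff
    by (auto simp: K_def zero_prod_def less_eq_vec_def matrix_vector_right_distrib
        matrix_vector_mult_scaleR distrib_right mult.assoc intro: add_mono mult_left_mono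
        simp del: transpose_matrix_vector)
  have e: "linear e"
    by (rule linearI) (auto simp: e_def sum.distrib sum_distrib_left distrib_left)
  have epos: "0 < e v" if "v \<in> K" "v \<noteq> 0" for v
  proof -
    obtain \<pi> s where v: "v = (\<pi>, s)" by (cases v)
    have nn: "\<And>i. 0 \<le> \<pi> $ i" "0 \<le> s" using that by (auto simp: v K_def less_eq_vec_def)
    have "e v \<noteq> 0"
    proof
      assume "e v = 0"
      then have "(\<Sum>i\<in>UNIV. \<pi> $ i) = 0" "s = 0"
        using nn sum_nonneg[of UNIV "\<lambda>i. \<pi> $ i"] by (auto simp: v e_def)
      then show False
        using that(2) nn by (auto simp: v sum_nonneg_eq_0_iff vec_eq_iff zero_prod_def)
    qed
    moreover have "0 \<le> e v" using nn by (simp add: v e_def sum_nonneg)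
    ultimately show ?thesis by simp
  qed
  let ?S = "{v \<in> K. e v = 1}"
  have "closed ?S"
  proof -
    have "?S = {v. (\<forall>i. 0 \<le> fst v $ i) \<and> 0 \<le> snd v
        \<and> (\<forall>i. (transpose A *v fst v) $ i \<le> snd v * c $ i) \<and> (\<Sum>i\<in>UNIV. fst v $ i) + snd v = 1}"
      by (auto simp: K_def e_def less_eq_vec_def)
    also have "closed \<dots>"
      unfolding matrix_vector_mult_def
      by (intro closed_Collect_conj closed_Collect_all closed_Collect_le closed_Collect_eq)
         (auto intro!: continuous_intros)
    finally show ?thesis .
  qed
  moreover have "?S \<subseteq> cbox (0, 0) (1, 1)"
  proof
    fix v assume v: "v \<in> ?S"
    obtain \<pi> s where vp: "v = (\<pi>, s)" by (cases v)
    have nn: "\<And>i. 0 \<le> \<pi> $ i" "0 \<le> s" using v by (auto simp: vp K_def less_eq_vec_def)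
    have "(\<Sum>i\<in>UNIV. \<pi> $ i) + s = 1" using v by (simp add: vp e_def)
    moreover have "\<pi> $ i \<le> (\<Sum>i\<in>UNIV. \<pi> $ i)" for i
      using nn by (intro member_le_sum) auto
    ultimately have "\<pi> $ i \<le> 1" "s \<le> 1" for i
      using nn sum_nonneg[of UNIV "\<lambda>i. \<pi> $ i"] by (force intro: order_trans)+
    then show "v \<in> cbox (0, 0) (1, 1)"
      using nn by (auto simp: vp cbox_Pair_eq mem_box_cart)
  qed
  ultimately have comp: "compact ?S"
    using bounded_cbox bounded_subset compact_eq_bounded_closed by blast
  have "(g, - t) \<bullet> p \<le> 0" if p: "p extreme_point_of ?S" for p
  proof -
    have face: "(conic hull {p}) face_of K"
      using extreme_point_of_slice_spans_face[OF K e epos p] .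
    obtain \<pi> s where ps: "p = (\<pi>, s)" by (cases p)
    have pK: "0 \<le> \<pi>" "0 \<le> s" "transpose A *v \<pi> \<le> s *\<^sub>R c" and e1: "(\<Sum>i\<in>UNIV. \<pi> $ i) + s = 1"
      using p by (auto simp: extreme_point_of_def K_def e_def ps)
    have hull: "v \<in> conic hull {p} \<longleftrightarrow> (\<exists>k\<ge>0. v = (k *\<^sub>R \<pi>, k * s))" for v
      by (auto simp: conic_hull_explicit ps)
    have faceD: "a \<in> conic hull {p} \<and> b \<in> conic hull {p}"
      if "a \<in> K" "b \<in> K" "x \<in> conic hull {p}" "x \<in> open_segment a b" for a b x
      using face that unfolding face_of_def by blast
    show ?thesis
    proof (cases "s = 0")
      case True
      \<comment> \<open>At height 0, embedding by \<open>v \<mapsto> (v, 0)\<close> turns the face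
        property in \<open>K\<close> into the face property in the recession cone, so the ray cut
        applies to \<open>\<pi>\<close>.\<close>
      have hull\<pi>: "v \<in> conic hull {\<pi>} \<longleftrightarrow> (v, 0) \<in> conic hull {p}" for v
        unfolding hull by (auto simp: True conic_hull_explicit)
      have "\<pi> \<noteq> 0" using e1 True by auto
      moreover have "(conic hull {\<pi>}) face_of dual_polyhedron A 0"
        unfolding face_of_def
      proof (intro conjI ballI impI)
        have "v \<in> dual_polyhedron A 0" if v: "v \<in> conic hull {\<pi>}" for v
        proof -
          have "(v, 0) \<in> K" using v face hull\<pi> face_of_imp_subset by blast
          then show ?thesis by (simp add: K_def dual_polyhedron_def)
        qed
        then show "conic hull {\<pi>} \<subseteq> dual_polyhedron A 0" by blast
        show "convex (conic hull {\<pi>})" by (simp add: convex_conic_hull)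
        fix a b x
        assume H: "a \<in> dual_polyhedron A 0" "b \<in> dual_polyhedron A 0" "x \<in> conic hull {\<pi>}"
          "x \<in> open_segment a b"
        have "(a, 0) \<in> conic hull {p} \<and> (b, 0) \<in> conic hull {p}"
        proof (rule faceD[of _ _ "(x, 0)"])
          show "(a, 0) \<in> K" "(b, 0) \<in> K" using H by (auto simp: K_def dual_polyhedron_def)
          show "(x, 0) \<in> conic hull {p}" using H hull\<pi> by blast
          show "(x, 0) \<in> open_segment (a, 0) (b, 0::real)" using H by (auto simp: in_segment)
        qed
        then show "a \<in> conic hull {\<pi>}" "b \<in> conic hull {\<pi>}" by (auto simp: hull\<pi>)
      qed
      ultimately have "g \<bullet> \<pi> \<le> 0" by (intro ray) (simp add: represents_extreme_ray_def)
      then show ?thesis by (simp add: ps True)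
    next
      case False
      then have s: "0 < s" using pK by simp
      \<comment> \<open>The ray through \<open>p\<close> meets height 1 in a single point. A segment
        of the dual polyhedron around it would have both endpoints on the ray, hence equal, so the
        point is extreme.\<close>
      have unique: "u = (1 / s) *\<^sub>R \<pi>" if "(u, 1) \<in> conic hull {p}" for u
      proof -
        obtain k where "u = k *\<^sub>R \<pi>" "k * s = 1" using \<open>(u, 1) \<in> _\<close> hull by auto
        then show ?thesis using s by (simp add: field_simps)
      qed
      have "(1 / s) *\<^sub>R \<pi> extreme_point_of dual_polyhedron A c"
        unfolding extreme_point_of_def
      proof (intro conjI ballI notI)
        have "transpose A *v ((1 / s) *\<^sub>R \<pi>) \<le> c"
          using pK s by (auto simp: less_eq_vec_def matrix_vector_mult_scaleR field_simps)
        then show "(1 / s) *\<^sub>R \<pi> \<in> dual_polyhedron A c"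
          using pK s by (auto simp: dual_polyhedron_def less_eq_vec_def)
        fix a b
        assume H: "a \<in> dual_polyhedron A c" "b \<in> dual_polyhedron A c"
          "(1 / s) *\<^sub>R \<pi> \<in> open_segment a b"
        have "(a, 1) \<in> conic hull {p} \<and> (b, 1) \<in> conic hull {p}"
        proof (rule faceD[of _ _ "((1 / s) *\<^sub>R \<pi>, 1)"])
          show "(a, 1) \<in> K" "(b, 1) \<in> K" using H by (auto simp: K_def dual_polyhedron_def)
          show "((1 / s) *\<^sub>R \<pi>, 1) \<in> conic hull {p}"
            unfolding hull using s by (intro exI[of _ "1 / s"]) auto
          show "((1 / s) *\<^sub>R \<pi>, 1) \<in> open_segment (a, 1) (b, 1::real)"
            using H by (auto simp: in_segment)
        qed
        then show False using unique H by (metis empty_iff open_segment_idem)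
      qed
      then have "g \<bullet> ((1 / s) *\<^sub>R \<pi>) \<le> t" by (rule pt)
      then show ?thesis using s by (simp add: ps field_simps)
    qed
  qed
  note slice = this
  \<comment> \<open>Pairing with \<open>(g, - t)\<close> expresses point cuts and ray cuts by one
    homogeneous inequality.\<close>
  have "(g, - t) \<bullet> (\<pi>0, s0) \<le> 0"
  proof (rule linear_bound_on_cone_of_slice[OF K e epos comp slice])
    show "(\<pi>0, s0) \<in> K" using v by (simp add: K_def)
  qed
  then show ?thesis by (simp add: mult.commute)
qed

text \<open>Strong duality in the form used for Benders cuts: the multipliers tested by the Farkas
  alternative form the cone that the cuts control.\<close>

lemma subproblem_solution_below_cuts:
  fixes A :: "real^'n^'m"
  assumes "\<And>r. represents_extreme_ray (dual_polyhedron A 0) r \<Longrightarrow> g \<bullet> r \<le> 0"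
    and "\<And>\<pi>. \<pi> extreme_point_of (dual_polyhedron A c) \<Longrightarrow> g \<bullet> \<pi> \<le> t"
  shows "\<exists>x\<ge>0. g \<le> A *v x \<and> c \<bullet> x \<le> t"
  using cuts_bound_homogenised_dual[OF assms] by (intro farkas_bounded_cost)

text \<open>A ray cut is homogeneous, so its validity does not depend on the representative.\<close>

lemma cuts_for_representatives_imp_all_rays:
  assumes "extreme_ray_representatives C R" "represents_extreme_ray C r"
    and "\<And>s. s \<in> R \<Longrightarrow> g \<bullet> s \<le> 0"
  shows "g \<bullet> r \<le> (0::real)"
proof -
  obtain s where s: "s \<in> R" "conic hull {s} = conic hull {r}"
    using assms(1,2) unfolding extreme_ray_representatives_def by blast
  have "r \<in> conic hull {s}"
    unfolding s(2) by (simp add: hull_inc)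
  then obtain k where "0 \<le> k" "r = k *\<^sub>R s"
    by (auto simp: conic_hull_explicit)
  then show ?thesis
    using assms(3)[OF s(1)] by (simp add: mult_nonneg_nonpos)
qed


section \<open>Bi-objective problems in objective space\<close>

text \<open>Only the image in objective space matters, so problems with different variables can be
  compared as planar sets.\<close>

lemma nondominated_extreme_points_iff:
  "v \<in> nondominated_extreme_points X z \<longleftrightarrow>
     v extreme_point_of (z ` X) \<and> (\<forall>w\<in>z ` X. \<not> dominates w v)"
  by (auto simp: nondominated_extreme_points_def nondominated_points_def
      efficient_solutions_def extreme_point_of_def)

lemma complete_efficient_extreme_setI:
  assumes "E \<subseteq> X" "nondominated_extreme_points X z = z ` E"
  shows "complete_efficient_extreme_set X z E"
proof -
  have "s \<in> efficient_extreme_solutions X z" if "s \<in> E" for s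
  proof -
    have "z s \<in> nondominated_extreme_points X z" using that assms(2) by blast
    then show ?thesis
      using that assms(1) nondominated_extreme_points_iff[of "z s" X z]
      by (auto simp: efficient_extreme_solutions_def efficient_solutions_def)
  qed
  then show ?thesis
    using assms(2) by (auto simp: complete_efficient_extreme_set_def)
qed

lemma complete_efficient_extreme_set_image:
  assumes "complete_efficient_extreme_set X z E"
  shows "nondominated_extreme_points X z = z ` E"
  using assms
  by (auto simp: complete_efficient_extreme_set_def efficient_extreme_solutions_def image_iff)
    metis

section \<open>Weighted sums as lines in the plane\<close>

lemma snd_le_of_weighted_sum_le:
  assumes "weighted_sum \<mu> v \<le> weighted_sum \<mu> w" "fst v = fst w" "\<mu> < 1"
  shows "snd v \<le> snd w"
  using assms by (simp add: weighted_sum_def)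

lemma weighted_sum_combination:
  "weighted_sum \<mu> ((1 - u) *\<^sub>R v + u *\<^sub>R w)
     = (1 - u) * weighted_sum \<mu> v + u * weighted_sum \<mu> w"
  by (simp add: weighted_sum_def algebra_simps)

text \<open>The linear system for the two weights has determinant
  \<open>\<mu> - \<nu>\<close>.\<close>

lemma eq_of_weighted_sums_eq:
  assumes "weighted_sum \<mu> v = weighted_sum \<mu> w" "weighted_sum \<nu> v = weighted_sum \<nu> w" "\<mu> \<noteq> \<nu>"
  shows "v = w"
proof -
  let ?p = "fst v - fst w" and ?q = "snd v - snd w"
  have eq: "\<mu> * ?p + (1 - \<mu>) * ?q = 0" "\<nu> * ?p + (1 - \<nu>) * ?q = 0"
    using assms(1,2) by (auto simp: weighted_sum_def algebra_simps)
  have "(\<mu> - \<nu>) * (?p - ?q) = (\<mu> * ?p + (1 - \<mu>) * ?q) - (\<nu> * ?p + (1 - \<nu>) * ?q)"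
    by (simp add: algebra_simps)
  then have "?p = ?q" using eq assms(3) by simp
  moreover have "?q = (\<mu> * ?p + (1 - \<mu>) * ?q) - \<mu> * (?p - ?q)"
    by (simp add: algebra_simps)
  ultimately have "?q = 0" using eq(1) by simp
  with \<open>?p = ?q\<close> show ?thesis by (simp add: prod_eq_iff)
qed

lemma weighted_sum_mono:
  assumes "fst v \<le> fst w" "snd v \<le> snd w" "0 \<le> \<mu>" "\<mu> \<le> 1"
  shows "weighted_sum \<mu> v \<le> weighted_sum \<mu> w"
  using assms by (auto simp: weighted_sum_def intro!: add_mono mult_left_mono)

text \<open>For \<open>\<mu> < 1\<close> a level line is not vertical, so its points are determined
  by their first coordinate.\<close>

lemma strictly_between_in_open_segment:
  fixes v m w :: "real \<times> real"
  assumes "fst v < fst m" "fst m < fst w" "\<mu> < 1"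
    and "weighted_sum \<mu> v = s" "weighted_sum \<mu> m = s" "weighted_sum \<mu> w = s"
  shows "m \<in> open_segment v w"
proof -
  define u where "u = (fst m - fst v) / (fst w - fst v)"
  define n where "n = (1 - u) *\<^sub>R v + u *\<^sub>R w"
  have u: "0 < u" "u < 1" using assms by (auto simp: u_def)
  have "u * (fst w - fst v) = fst m - fst v" using assms by (simp add: u_def)
  then have "fst n = fst m" by (simp add: n_def algebra_simps)
  moreover have "weighted_sum \<mu> n = s"
    unfolding n_def weighted_sum_combination using assms by (simp add: algebra_simps)
  ultimately have "m = n"
    using snd_le_of_weighted_sum_le[of \<mu> m n] snd_le_of_weighted_sum_le[of \<mu> n m] assms
    by (simp add: prod_eq_iff)
  moreover have "v \<noteq> w" using assms by auto
  ultimately show ?thesis using u by (auto simp: in_segment n_def)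
qed

lemma dominating_point_on_segment:
  fixes v w p :: "real \<times> real"
  assumes "fst v \<le> fst p" "fst p < fst w" "\<mu> < 1"
    and "weighted_sum \<mu> v \<le> weighted_sum \<mu> p" "weighted_sum \<mu> w \<le> weighted_sum \<mu> p"
  obtains n where "n \<in> closed_segment v w" "fst n \<le> fst p" "snd n \<le> snd p"
proof -
  \<comment> \<open>Chosen so that \<open>n\<close> has the first coordinate of \<open>p\<close>;
    the weighted sums then place \<open>n\<close> at or below \<open>p\<close>.\<close>
  define u where "u = (fst p - fst v) / (fst w - fst v)"
  define n where "n = (1 - u) *\<^sub>R v + u *\<^sub>R w"
  have u: "0 \<le> u" "u \<le> 1" using assms by (auto simp: u_def)
  have "u * (fst w - fst v) = fst p - fst v" using assms by (simp add: u_def)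
  then have f: "fst n = fst p" by (simp add: n_def algebra_simps)
  have "weighted_sum \<mu> n \<le> (1 - u) * weighted_sum \<mu> p + u * weighted_sum \<mu> p"
    unfolding n_def weighted_sum_combination using assms u by (intro add_mono mult_left_mono) auto
  then have "snd n \<le> snd p"
    using f assms by (intro snd_le_of_weighted_sum_le[of \<mu>]) (simp_all add: algebra_simps)
  then show ?thesis
    using u f by (intro that[of n]) (auto simp: in_segment n_def)
qed

text \<open>\<open>Z\<close> stands for the image of the linear program and \<open>W\<close> for
  that of a reformulation. The cuts enter only through \<open>opt\<close>: \<open>z i\<close>
  minimises over the larger set \<open>W\<close> at both ends of its range.\<close>

locale supported_frontier =
  fixes Z W :: "(real \<times> real) set" and z :: "nat \<Rightarrow> real \<times> real" and a :: "nat \<Rightarrow> real" and q :: nat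
  assumes convex_Z: "convex Z" and sub: "Z \<subseteq> W"
    and zZ: "\<And>i. i \<in> {1..q} \<Longrightarrow> z i \<in> Z"
    and z_ext: "\<And>i. i \<in> {1..q} \<Longrightarrow> z i extreme_point_of Z"
    and z_nondom: "\<And>i w. i \<in> {1..q} \<Longrightarrow> w \<in> Z \<Longrightarrow> \<not> dominates w (z i)"
    and ordered: "strict_mono_on {1..q} (\<lambda>i. fst (z i))"
    and a_first: "a 1 = 1" and a_last: "a (q + 1) = 0"
    and a_ranges: "\<And>i. i \<in> {1..q} \<Longrightarrow> a (i + 1) \<le> a i"
    and opt: "\<And>i w. i \<in> {1..q} \<Longrightarrow> w \<in> W \<Longrightarrow> weighted_sum (a i) (z i) \<le> weighted_sum (a i) w"
      "\<And>i w. i \<in> {1..q} \<Longrightarrow> w \<in> W \<Longrightarrow>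
        weighted_sum (a (i + 1)) (z i) \<le> weighted_sum (a (i + 1)) w"
begin

section \<open>Breakpoints of the optimality ranges\<close>

lemma q_pos: "1 \<le> q"
  using a_first a_last by (cases q) auto

lemma zW: "i \<in> {1..q} \<Longrightarrow> z i \<in> W"
  using zZ sub by blast

lemma z_less: "1 \<le> i \<Longrightarrow> i < j \<Longrightarrow> j \<le> q \<Longrightarrow> fst (z i) < fst (z j)"
  using ordered by (auto simp: strict_mono_on_def)

text \<open>The ranges of \<open>z i\<close> and \<open>z (i + 1)\<close> share the endpoint
  \<open>a (i + 1)\<close>, so both points minimise there.\<close>

lemma consecutive_opt_eq:
  assumes "1 \<le> i" "i < q"
  shows "weighted_sum (a (i + 1)) (z i) = weighted_sum (a (i + 1)) (z (i + 1))"
  using opt(2)[of i "z (i + 1)"] opt(1)[of "i + 1" "z i"] zW[of i] zW[of "i + 1"] assms by auto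

lemma a_bounds:
  assumes "i \<in> {1..q + 1}"
  shows "a i \<in> {0..1}"
proof -
  have "1 \<le> i" "i \<le> q + 1" using assms by auto
  then have "a i \<le> 1"
  proof (induction i rule: nat_induct_at_least)
    case (Suc n)
    then show ?case using a_ranges[of n] by simp
  qed (use a_first in simp)
  moreover from \<open>i \<le> q + 1\<close> \<open>1 \<le> i\<close> have "0 \<le> a i"
  proof (induction i rule: inc_induct)
    case (step n)
    then show ?case using a_ranges[of n] by simp
  qed (use a_last in simp)
  ultimately show ?thesis by simp
qed

lemma a_less_one:
  assumes "1 \<le> i" "i < q"
  shows "a (i + 1) < 1"
proof -
  \<comment> \<open>Weight 1 would force equal first objectives on two consecutive points.\<close>
  have "a (i + 1) \<noteq> 1"
    using consecutive_opt_eq[OF assms] z_less[of i "i + 1"] assms by (auto simp: weighted_sum_def)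
  then show ?thesis using a_bounds[of "i + 1"] assms by simp
qed

lemma a_pos:
  assumes "1 \<le> i" "i < q"
  shows "0 < a (i + 1)"
proof -
  have "a (i + 1) \<noteq> 0"
  proof
    assume "a (i + 1) = 0"
    then have "dominates (z i) (z (i + 1))"
      using consecutive_opt_eq[OF assms] z_less[of i "i + 1"] assms
      by (auto simp: weighted_sum_def dominates_def)
    then show False using z_nondom[of "i + 1" "z i"] zZ[of i] assms by simp
  qed
  then show ?thesis using a_bounds[of "i + 1"] assms by simp
qed

text \<open>Otherwise \<open>z (i - 1)\<close>, \<open>z i\<close>, \<open>z (i + 1)\<close> would lie on one supporting line and
  \<open>z i\<close> would not be extreme.\<close>

lemma a_strict:
  assumes i: "i \<in> {1..q}"
  shows "a (i + 1) < a i"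
proof (rule ccontr)
  assume "\<not> a (i + 1) < a i"
  then have eq: "a (i + 1) = a i" using a_ranges[OF i] by simp
  \<comment> \<open>Only an interior \<open>i\<close> has neighbours on both sides; at the ends the
    values 1 and 0 of \<open>a\<close> are compared with the strict bounds on the inner
    breakpoints.\<close>
  consider "i = 1" "q = 1" | "i = 1" "1 < q" | "1 < i" "i = q" | j where "i = j + 1" "1 \<le> j" "i < q"
    using i by (cases i) (auto, fastforce)
  then show False
  proof cases
    case 1
    then show ?thesis using a_first a_last eq by simp
  next
    case 2
    then show ?thesis using a_first eq a_less_one[of 1] by simp
  next
    case 3
    then have "0 < a i" using a_pos[of "i - 1"] by simp
    then show ?thesis using 3 a_last eq by simp
  next
    case (4 j)
    have "z i \<in> open_segment (z j) (z (i + 1))"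
    proof (rule strictly_between_in_open_segment)
      show "fst (z j) < fst (z i)" "fst (z i) < fst (z (i + 1))" using 4 z_less by auto
      show "a i < 1" using 4 a_less_one[of j] by simp
      show "weighted_sum (a i) (z j) = weighted_sum (a i) (z i)"
        using 4 consecutive_opt_eq[of j] by simp
      show "weighted_sum (a i) (z (i + 1)) = weighted_sum (a i) (z i)"
        using 4 consecutive_opt_eq[of i] eq by simp
    qed simp
    then show ?thesis
      using z_ext[OF i] zZ[of j] zZ[of "i + 1"] 4 by (auto simp: extreme_point_of_def)
  qed
qed

text \<open>The two supporting lines at \<open>z i\<close> have different weights by
  \<open>a_strict\<close>, hence meet only in \<open>z i\<close>.\<close>

lemma z_unique_minimiser:
  assumes i: "i \<in> {1..q}"
    and "weighted_sum (a i) w \<le> weighted_sum (a i) (z i)" "w \<in> W"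
    and "weighted_sum (a (i + 1)) w \<le> weighted_sum (a (i + 1)) (z i)"
  shows "w = z i"
proof (rule eq_of_weighted_sums_eq)
  show "weighted_sum (a i) w = weighted_sum (a i) (z i)"
    using assms(2) opt(1)[OF i \<open>w \<in> W\<close>] by (rule antisym)
  show "weighted_sum (a (i + 1)) w = weighted_sum (a (i + 1)) (z i)"
    using assms(4) opt(2)[OF i \<open>w \<in> W\<close>] by (rule antisym)
  show "a i \<noteq> a (i + 1)" using a_strict[OF i] by simp
qed

lemma z_nondominated:
  assumes i: "i \<in> {1..q}" and w: "w \<in> W"
  shows "\<not> dominates w (z i)"
proof
  assume "dominates w (z i)"
  then have le: "fst w \<le> fst (z i)" "snd w \<le> snd (z i)" and "w \<noteq> z i"
    by (auto simp: dominates_def)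
  have "w = z i"
    using i w a_bounds[of i] a_bounds[of "i + 1"]
    by (intro z_unique_minimiser weighted_sum_mono le) auto
  then show False using \<open>w \<noteq> z i\<close> by simp
qed

lemma z_extreme:
  assumes i: "i \<in> {1..q}"
  shows "z i extreme_point_of W"
  unfolding extreme_point_of_def
proof (intro conjI ballI notI)
  show "z i \<in> W" using zW[OF i] .
  fix v w assume vw: "v \<in> W" "w \<in> W" "z i \<in> open_segment v w"
  then obtain u where u: "0 < u" "u < 1" "z i = (1 - u) *\<^sub>R v + u *\<^sub>R w" and "v \<noteq> w"
    by (auto simp: in_segment)
  \<comment> \<open>If a proper average of two values attains their common lower bound, each value
    attains it.\<close>
  have tight: "weighted_sum \<mu> v \<le> weighted_sum \<mu> (z i)"
    if "\<And>w. w \<in> W \<Longrightarrow> weighted_sum \<mu> (z i) \<le> weighted_sum \<mu> w" for \<mu>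
  proof -
    have "(1 - u) * (weighted_sum \<mu> v - weighted_sum \<mu> (z i))
        = - (u * (weighted_sum \<mu> w - weighted_sum \<mu> (z i)))"
      using weighted_sum_combination[of \<mu> u v w, folded u(3)] by (simp add: algebra_simps)
    also have "\<dots> \<le> 0" using that[OF vw(2)] u by simp
    finally show ?thesis using u by (simp add: mult_le_0_iff)
  qed
  have "v = z i"
    using i vw(1) by (intro z_unique_minimiser tight opt) auto
  then have "u *\<^sub>R v = u *\<^sub>R w" using u(3) by (simp add: algebra_simps)
  then show False using u \<open>v \<noteq> w\<close> by simp
qed

section \<open>Points above all supporting lines\<close>

lemma weakly_dominated_by_hull:
  assumes w: "w \<in> W"
  obtains n where "n \<in> convex hull (z ` {1..q})" "fst n \<le> fst w" "snd n \<le> snd w"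
proof (cases "fst (z q) \<le> fst w")
  case True
  \<comment> \<open>The final weight \<open>a (q + 1) = 0\<close> is the one that bounds the second
    objective from below.\<close>
  moreover have "snd (z q) \<le> snd w"
    using opt(2)[of q w] w q_pos a_last by (simp add: weighted_sum_def)
  ultimately show ?thesis using q_pos by (intro that[of "z q"]) (auto intro: hull_inc)
next
  case False
  have first: "fst (z 1) \<le> fst w"
    using opt(1)[of 1 w] w q_pos a_first by (simp add: weighted_sum_def)
  \<comment> \<open>Since \<open>fst (z 1) \<le> fst w < fst (z q)\<close>, some consecutive pair
    brackets \<open>fst w\<close>; their common supporting line then gives a point of the segment
    below \<open>w\<close>.\<close>
  have "\<exists>i. 1 \<le> i \<and> i < q \<and> fst (z i) \<le> fst w \<and> fst w < fst (z (i + 1))"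
  proof (rule ccontr)
    assume no: "\<not> ?thesis"
    have "1 \<le> i \<Longrightarrow> i \<le> q \<Longrightarrow> fst (z i) \<le> fst w" for i
    proof (induction i rule: nat_induct_at_least)
      case (Suc n)
      then show ?case using no by (metis Suc_eq_plus1 Suc_leD Suc_le_eq not_less)
    qed (use first in simp)
    then show False using False q_pos by blast
  qed
  then obtain i where i: "1 \<le> i" "i < q" and between: "fst (z i) \<le> fst w" "fst w < fst (z (i + 1))"
    by blast
  obtain n where n: "n \<in> closed_segment (z i) (z (i + 1))" "fst n \<le> fst w" "snd n \<le> snd w"
  proof (rule dominating_point_on_segment[OF between a_less_one[OF i]])
    show "weighted_sum (a (i + 1)) (z i) \<le> weighted_sum (a (i + 1)) w"
      "weighted_sum (a (i + 1)) (z (i + 1)) \<le> weighted_sum (a (i + 1)) w"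
      using opt(2)[of i w] opt(1)[of "i + 1" w] i w by auto
  qed
  have "closed_segment (z i) (z (i + 1)) \<subseteq> convex hull (z ` {1..q})"
    unfolding segment_convex_hull using i by (intro hull_mono) auto
  then show ?thesis using n by (intro that[of n]) auto
qed

theorem nondominated_extreme_iff:
  "v extreme_point_of W \<and> (\<forall>w\<in>W. \<not> dominates w v) \<longleftrightarrow> v \<in> z ` {1..q}"
proof
  assume v: "v extreme_point_of W \<and> (\<forall>w\<in>W. \<not> dominates w v)"
  then have "v \<in> W" by (simp add: extreme_point_of_def)
  then obtain n where n: "n \<in> convex hull (z ` {1..q})" "fst n \<le> fst v" "snd n \<le> snd v"
    by (rule weakly_dominated_by_hull)
  have hull: "convex hull (z ` {1..q}) \<subseteq> W"
    using convex_Z sub zZ by (meson hull_minimal image_subsetI order_trans)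
  then have "v = n"
    using v n by (auto simp: dominates_def)
  \<comment> \<open>Extremality in \<open>W\<close> passes to the smaller hull, whose extreme points
    are among its generators.\<close>
  then have "v extreme_point_of (convex hull (z ` {1..q}))"
    using v n hull by (auto simp: extreme_point_of_def)
  then show "v \<in> z ` {1..q}" by (rule extreme_point_of_convex_hull)
qed (use z_extreme z_nondominated in blast)

end


section \<open>The linear program and its Benders reformulations\<close>

lemma convex_blp_image: "convex (blp_objective c1 c2 f1 f2 ` blp_feasible A B b D d)"
proof (rule convex_linear_image)
  show "linear (blp_objective c1 c2 f1 f2)"
    by (rule linearI) (auto simp: blp_objective_def inner_simps algebra_simps)
  have comb: "l \<le> u *\<^sub>R v + t *\<^sub>R w" if "l \<le> v" "l \<le> w" "0 \<le> u" "0 \<le> t" "u + t = 1"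
    for l v w :: "real^'x" and u t
    unfolding less_eq_vec_def
  proof
    fix i
    have "u * l $ i + t * l $ i \<le> u * v $ i + t * w $ i"
      using that by (intro add_mono mult_left_mono) (auto simp: less_eq_vec_def)
    then show "l $ i \<le> (u *\<^sub>R v + t *\<^sub>R w) $ i"
      using that(5) by (simp flip: distrib_right)
  qed
  show "convex (blp_feasible A B b D d)"
    unfolding convex_def
  proof (intro ballI allI impI)
    fix p p' and u t :: real
    assume p: "p \<in> blp_feasible A B b D d" "p' \<in> blp_feasible A B b D d"
      and ut: "0 \<le> u" "0 \<le> t" "u + t = 1"
    obtain x y x' y' where xy: "p = (x, y)" "p' = (x', y')" by (cases p, cases p')
    note comb = comb[OF _ _ ut]
    have "A *v (u *\<^sub>R x + t *\<^sub>R x') + B *v (u *\<^sub>R y + t *\<^sub>R y')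
        = u *\<^sub>R (A *v x + B *v y) + t *\<^sub>R (A *v x' + B *v y')"
      by (simp add: matrix_vector_right_distrib matrix_vector_mult_scaleR scaleR_right_distrib)
    moreover have "D *v (u *\<^sub>R y + t *\<^sub>R y') = u *\<^sub>R (D *v y) + t *\<^sub>R (D *v y')"
      by (simp add: matrix_vector_right_distrib matrix_vector_mult_scaleR)
    ultimately show "u *\<^sub>R p + t *\<^sub>R p' \<in> blp_feasible A B b D d"
      using p by (simp add: xy blp_feasible_def comb)
  qed
qed

text \<open>Weak duality; with \<open>c = 0\<close> it yields the ray cuts, with the weighted cost
  the point cuts.\<close>

lemma dual_feasible_cut:
  assumes "(x, y) \<in> blp_feasible A B b D d" "\<pi> \<in> dual_polyhedron A c"
  shows "(b - B *v y) \<bullet> \<pi> \<le> c \<bullet> x"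
proof -
  have x: "b \<le> A *v x + B *v y" "0 \<le> x" and \<pi>: "transpose A *v \<pi> \<le> c" "0 \<le> \<pi>"
    using assms by (auto simp: blp_feasible_def dual_polyhedron_def)
  have "b - B *v y \<le> A *v x" using x(1) by (simp add: less_eq_vec_def algebra_simps)
  then have "(b - B *v y) \<bullet> \<pi> \<le> (A *v x) \<bullet> \<pi>" using \<pi>(2) by (rule inner_mono_vec)
  also have "\<dots> = (transpose A *v \<pi>) \<bullet> x"
    by (metis inner_commute inner_transpose_matrix_vector)
  also have "\<dots> \<le> c \<bullet> x" using \<pi>(1) x(2) by (rule inner_mono_vec)
  finally show ?thesis .
qed

lemma blp_feasible_imp_br_feasible:
  assumes "(x, y) \<in> blp_feasible A B b D d" "extreme_ray_representatives (dual_polyhedron A 0) R"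
  shows "(c1 \<bullet> x, c2 \<bullet> x, y) \<in> br_feasible B b D d R L (dual_extreme_points A c1 c2)"
proof -
  have "(b - B *v y) \<bullet> \<pi> \<le> 0" if "\<pi> \<in> R" for \<pi>
  proof -
    have "(conic hull {\<pi>}) \<subseteq> dual_polyhedron A 0"
      using assms(2) that face_of_imp_subset
      unfolding extreme_ray_representatives_def represents_extreme_ray_def by blast
    then have "\<pi> \<in> dual_polyhedron A 0" by (meson hull_inc insertI1 subsetD)
    from dual_feasible_cut[OF assms(1) this] show ?thesis by simp
  qed
  moreover have "(b - B *v y) \<bullet> \<pi> \<le> \<mu> * (c1 \<bullet> x) + (1 - \<mu>) * (c2 \<bullet> x)"
    if "\<pi> \<in> dual_extreme_points A c1 c2 \<mu>" for \<pi> \<mu>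
  proof -
    have "\<pi> \<in> dual_polyhedron A (weighted_cost c1 c2 \<mu>)"
      using that by (simp add: dual_extreme_points_def extreme_point_of_def)
    from dual_feasible_cut[OF assms(1) this] show ?thesis
      by (simp add: weighted_cost_def inner_simps)
  qed
  ultimately show ?thesis
    using assms(1) by (auto simp: br_feasible_def blp_feasible_def)
qed

text \<open>The cuts for a single \<open>\<mu>\<close> yield an \<open>x\<close> for the given
  \<open>y\<close>. This \<open>x\<close> may depend on \<open>\<mu>\<close>, so the comparison is
  made one weight at a time.\<close>

lemma br_feasible_weighted_sum_bound:
  assumes rays: "extreme_ray_representatives (dual_polyhedron A 0) R"
    and feas: "(\<theta>1, \<theta>2, y) \<in> br_feasible B b D d R L (dual_extreme_points A c1 c2)" and "\<mu> \<in> L"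
  shows "\<exists>x. (x, y) \<in> blp_feasible A B b D d \<and>
    weighted_sum \<mu> (blp_objective c1 c2 f1 f2 (x, y))
      \<le> weighted_sum \<mu> (br_objective f1 f2 (\<theta>1, \<theta>2, y))"
proof -
  have "\<exists>x\<ge>0. b - B *v y \<le> A *v x
      \<and> weighted_cost c1 c2 \<mu> \<bullet> x \<le> \<mu> * \<theta>1 + (1 - \<mu>) * \<theta>2"
  proof (rule subproblem_solution_below_cuts)
    show "(b - B *v y) \<bullet> r \<le> 0" if "represents_extreme_ray (dual_polyhedron A 0) r" for r
      using feas by (intro cuts_for_representatives_imp_all_rays[OF rays that]) (auto simp: br_feasible_def)
    show "(b - B *v y) \<bullet> \<pi> \<le> \<mu> * \<theta>1 + (1 - \<mu>) * \<theta>2"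
      if "\<pi> extreme_point_of dual_polyhedron A (weighted_cost c1 c2 \<mu>)" for \<pi>
      using feas that \<open>\<mu> \<in> L\<close> by (auto simp: br_feasible_def dual_extreme_points_def)
  qed
  then obtain x where x: "0 \<le> x" "b - B *v y \<le> A *v x"
    "weighted_cost c1 c2 \<mu> \<bullet> x \<le> \<mu> * \<theta>1 + (1 - \<mu>) * \<theta>2" by blast
  have "b \<le> A *v x + B *v y" using x(2) by (simp add: less_eq_vec_def algebra_simps)
  then have "(x, y) \<in> blp_feasible A B b D d"
    using x(1) feas by (simp add: blp_feasible_def br_feasible_def)
  moreover have "weighted_sum \<mu> (blp_objective c1 c2 f1 f2 (x, y))
      \<le> weighted_sum \<mu> (br_objective f1 f2 (\<theta>1, \<theta>2, y))"
    using x(3)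
    by (simp add: weighted_sum_def blp_objective_def br_objective_def weighted_cost_def
        inner_simps algebra_simps)
  ultimately show ?thesis by blast
qed

theorem proposition1:
  fixes A :: "real^'n^'m" and B :: "real^'p^'m" and b :: "real^'m"
    and D :: "real^'p^'k" and d :: "real^'k"
    and c1 c2 :: "real^'n" and f1 f2 :: "real^'p"
    and q :: nat and x :: "nat \<Rightarrow> real^'n" and y :: "nat \<Rightarrow> real^'p" and a :: "nat \<Rightarrow> real"
    and z :: "nat \<Rightarrow> real \<times> real" and \<theta>1 \<theta>2 :: "nat \<Rightarrow> real"
    and Xe :: "((real^'n) \<times> (real^'p)) set" and Xer :: "(real \<times> real \<times> (real^'p)) set"
    and Zn :: "(real \<times> real) set" and Dr :: "(real^'m) set" and \<Lambda> :: "real set"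
  assumes feasible: "blp_feasible A B b D d \<noteq> {}"
    and bounded_efficient:
      "bounded (efficient_solutions (blp_feasible A B b D d) (blp_objective c1 c2 f1 f2))"
    and weighted_solvable:
      "\<And>\<mu>. \<mu> \<in> {0..1} \<Longrightarrow>
        \<exists>s. weighted_sum_optimal (blp_feasible A B b D d) (blp_objective c1 c2 f1 f2) \<mu> s"
    and rays: "extreme_ray_representatives (dual_polyhedron A 0) Dr"
    and Xe: "Xe = (\<lambda>i. (x i, y i)) ` {1..q}"
    and complete:
      "complete_efficient_extreme_set (blp_feasible A B b D d) (blp_objective c1 c2 f1 f2) Xe"
    and z: "\<And>i. i \<in> {1..q} \<Longrightarrow> z i = blp_objective c1 c2 f1 f2 (x i, y i)"
    and ordered: "strict_mono_on {1..q} (\<lambda>i. fst (z i))"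
    and a_first: "a 1 = 1" and a_last: "a (q + 1) = 0"
    and a_ranges: "\<And>i. i \<in> {1..q} \<Longrightarrow> a (i + 1) \<le> a i"
    and optimality:
      "\<And>i \<mu>. i \<in> {1..q} \<Longrightarrow> \<mu> \<in> {a (i + 1)..a i} \<Longrightarrow>
        weighted_sum_optimal (blp_feasible A B b D d) (blp_objective c1 c2 f1 f2) \<mu> (x i, y i)"
    and Zn: "Zn = z ` {1..q}"
    and \<theta>1: "\<And>i. i \<in> {1..q} \<Longrightarrow> \<theta>1 i = c1 \<bullet> x i"
    and \<theta>2: "\<And>i. i \<in> {1..q} \<Longrightarrow> \<theta>2 i = c2 \<bullet> x i"
    and Xer: "Xer = (\<lambda>i. (\<theta>1 i, \<theta>2 i, y i)) ` {1..q}"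
    and \<Lambda>: "\<Lambda> = a ` {1..q + 1}"
  shows
    "\<Lambda> \<subseteq> {0..1} \<and>
     (\<exists>Dr' Dp'.
        Dr' \<subseteq> Dr \<and> (\<forall>\<mu>\<in>\<Lambda>. Dp' \<mu> \<subseteq> dual_extreme_points A c1 c2 \<mu>) \<and>
        complete_efficient_extreme_set
          (br_feasible B b D d Dr' \<Lambda> Dp') (br_objective f1 f2) Xer \<and>
        nondominated_extreme_points
          (br_feasible B b D d Dr' \<Lambda> Dp') (br_objective f1 f2) = Zn) \<and>
     nondominated_extreme_points
       (blp_feasible A B b D d) (blp_objective c1 c2 f1 f2) = Zn \<and>
     (\<forall>i\<in>{1..q}. z i = (f1 \<bullet> y i + \<theta>1 i, f2 \<bullet> y i + \<theta>2 i)) \<and>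
     (\<forall>L \<in> {{0..1}, \<Lambda>}.
        complete_efficient_extreme_set
          (br_feasible B b D d Dr L (dual_extreme_points A c1 c2)) (br_objective f1 f2) Xer \<and>
        nondominated_extreme_points
          (br_feasible B b D d Dr L (dual_extreme_points A c1 c2)) (br_objective f1 f2) = Zn)"
proof -
  let ?X = "blp_feasible A B b D d" and ?o = "blp_objective c1 c2 f1 f2"
  let ?Y = "\<lambda>L. br_feasible B b D d Dr L (dual_extreme_points A c1 c2)" and ?r = "br_objective f1 f2"
  have Xe_X: "(x i, y i) \<in> ?X" if "i \<in> {1..q}" for i
  proof -
    have "(x i, y i) \<in> Xe" using that by (auto simp: Xe)
    then show ?thesis
      using complete
      by (auto simp: complete_efficient_extreme_set_def efficient_extreme_solutions_def
          efficient_solutions_def)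
  qed
  have blp: "nondominated_extreme_points ?X ?o = Zn"
    using complete_efficient_extreme_set_image[OF complete] z by (auto simp: Xe Zn image_image)
  have z_eq: "z i = (f1 \<bullet> y i + \<theta>1 i, f2 \<bullet> y i + \<theta>2 i)" if "i \<in> {1..q}" for i
    using z \<theta>1 \<theta>2 that by (simp add: blp_objective_def)
  \<comment> \<open>Allowing any \<open>L\<close> above \<open>\<Lambda>\<close> treats the complete
    reformulation and the one restricted to \<open>\<Lambda>\<close> together.\<close>
  have frontier: "supported_frontier (?o ` ?X) (?r ` ?Y L) z a q" if L: "\<Lambda> \<subseteq> L" for L
  proof
    have bound: "weighted_sum \<mu> (z i) \<le> weighted_sum \<mu> w"
      if i: "i \<in> {1..q}" and \<mu>: "\<mu> \<in> {a (i + 1), a i}" and w: "w \<in> ?r ` ?Y L" for i \<mu> w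
    proof -
      have "\<mu> \<in> \<Lambda>" using i \<mu> by (auto simp: \<Lambda>)
      then have "\<mu> \<in> L" using L by blast
      obtain t1 t2 y' where w': "w = ?r (t1, t2, y')" "(t1, t2, y') \<in> ?Y L" using w by auto
      obtain x' where x': "(x', y') \<in> ?X" "weighted_sum \<mu> (?o (x', y')) \<le> weighted_sum \<mu> w"
        using br_feasible_weighted_sum_bound[OF rays w'(2) \<open>\<mu> \<in> L\<close>] w'(1) by blast
      have "weighted_sum_optimal ?X ?o \<mu> (x i, y i)"
        using i \<mu> a_ranges[OF i] by (intro optimality) auto
      then have "weighted_sum \<mu> (z i) \<le> weighted_sum \<mu> (?o (x', y'))"
        using x'(1) z[OF i] by (simp add: weighted_sum_optimal_def)
      then show ?thesis using x'(2) by simp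
    qed
    then show "weighted_sum (a i) (z i) \<le> weighted_sum (a i) w"
      "weighted_sum (a (i + 1)) (z i) \<le> weighted_sum (a (i + 1)) w"
      if "i \<in> {1..q}" "w \<in> ?r ` ?Y L" for i w using that by auto
    show "?o ` ?X \<subseteq> ?r ` ?Y L"
    proof (intro image_subsetI)
      fix p assume "p \<in> ?X"
      moreover obtain x' y' where "p = (x', y')" by (cases p)
      ultimately have "(c1 \<bullet> x', c2 \<bullet> x', y') \<in> ?Y L" "?o p = ?r (c1 \<bullet> x', c2 \<bullet> x', y')"
        using blp_feasible_imp_br_feasible rays by (auto simp: blp_objective_def br_objective_def)
      then show "?o p \<in> ?r ` ?Y L" by (rule rev_image_eqI)
    qed
    have "z i \<in> nondominated_extreme_points ?X ?o" if "i \<in> {1..q}" for i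
      using that by (simp add: blp Zn)
    then show "z i \<in> ?o ` ?X" "z i extreme_point_of ?o ` ?X"
      "w \<in> ?o ` ?X \<Longrightarrow> \<not> dominates w (z i)" if "i \<in> {1..q}" for i w
      using that nondominated_extreme_points_iff[of "z i" ?X ?o]
      by (auto simp: extreme_point_of_def)
  qed (use ordered a_first a_last a_ranges convex_blp_image in auto)
  have nep: "nondominated_extreme_points (?Y L) ?r = Zn" if "\<Lambda> \<subseteq> L" for L
    using supported_frontier.nondominated_extreme_iff[OF frontier[OF that]]
      nondominated_extreme_points_iff[of _ "?Y L" ?r] Zn by blast
  have compl: "complete_efficient_extreme_set (?Y L) ?r Xer" if "\<Lambda> \<subseteq> L" for L
  proof (rule complete_efficient_extreme_setI)
    show "Xer \<subseteq> ?Y L"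
      using blp_feasible_imp_br_feasible[OF Xe_X rays] \<theta>1 \<theta>2 by (auto simp: Xer)
    show "nondominated_extreme_points (?Y L) ?r = ?r ` Xer"
      unfolding nep[OF that] Zn Xer image_image
      by (intro image_cong) (auto simp: z_eq br_objective_def)
  qed
  have "\<Lambda> \<subseteq> {0..1}"
    using supported_frontier.a_bounds[OF frontier[OF order_refl]] by (auto simp: \<Lambda>)
  \<comment> \<open>The existential is witnessed by \<open>Dr\<close> and all dual extreme points,
    from the case \<open>L = \<Lambda>\<close>.\<close>
  then show ?thesis
    using nep compl blp z_eq by blast
qed

end
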